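(* There is an absolute constant $C>0$ such that the following holds. Let $L>0$, $A\in[-L,L]^{n\times m}$ and $\epsilon>0$. Set $k=\max\{C\max\{\log^2n,\log^2m\}/\epsilon^2,\ (1/\epsilon)^{C/\epsilon^2}\}$. Consider the randomized procedure: let $S_R\subseteq\{1,\dots,n\}$ include each index independently with probability $k/n$ and $S_C\subseteq\{1,\dots,m\}$ include each index independently with probability $k/m$; if $|S_R|>2k$ or $|S_C|>2k$, abort; otherwise output $z=\sqrt{\frac{nm}{|S_R||S_C|}}\,\sigma_1(A|_{S_R\times S_C})$. Then with probability at least $2/3$ the procedure does not abort and outputs $z$ with $|\sigma_1(A)-z|\le\epsilon L\sqrt{nm}$.
   Context: $\sigma_1(M)$ is the largest singular value of a matrix $M$. $A|_{S_R\times S_C}\in\mathbb{R}^{|S_R|\times|S_C|}$ is the submatrix of $A$ with rows indexed by $S_R$ and columns indexed by $S_C$.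
   Formalization: The formal theorem assumes ε ≤ 1, since for large ε (e.g. n = m = 100, k just below 1) the procedure aborts with probability above 1/3; inclusion probabilities are min(1, k/n) and min(1, k/m), since k may exceed n or m. *)

theory Defs
  imports
    "HOL-Probability.Probability"
    "Jordan_Normal_Form.Char_Poly"
    "Jordan_Normal_Form.DL_Submatrix"
begin

text \<open>
  The singular values of a real matrix \<open>M\<close> are the square roots of the eigenvalues of
  \<open>M\<^sup>T M\<close>, which are all nonnegative. Inserting \<open>0\<close> below therefore only matters for a
  matrix without columns, which has no singular values; its \<open>\<sigma>\<^sub>1\<close> is \<open>0\<close> by convention.
\<close>

definition singular_values :: "real mat \<Rightarrow> real set" where
  "singular_values M = {sqrt l |l. eigenvalue (transpose_mat M * M) l}"

definition sigma1 :: "real mat \<Rightarrow> real" where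
  "sigma1 M = Max (insert 0 (singular_values M))"

text \<open>The index set is \<open>{0, \<dots>, n - 1}\<close>, in line with the indexing of matrices.\<close>

definition random_subset_pmf :: "nat \<Rightarrow> real \<Rightarrow> nat set pmf" where
  "random_subset_pmf n p =
     map_pmf (\<lambda>b. {i. i < n \<and> b i}) (Pi_pmf {..<n} False (\<lambda>_. bernoulli_pmf p))"

text \<open>
  The value \<open>None\<close> means that the procedure aborts. Inclusion probabilities are capped at
  \<open>1\<close>, since \<open>k\<close> may exceed a dimension of the matrix. If one of the sampled sets is empty,
  the output is \<open>0\<close> (the submatrix is empty or has only the singular value \<open>0\<close>).
\<close>

definition sampling_procedure :: "real mat \<Rightarrow> real \<Rightarrow> real option pmf" where
  "sampling_procedure A k =
     (let n = dim_row A; m = dim_col A in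
      map_pmf
        (\<lambda>(S\<^sub>R, S\<^sub>C).
           if real (card S\<^sub>R) > 2 * k \<or> real (card S\<^sub>C) > 2 * k then None
           else Some (sqrt (real (n * m) / real (card S\<^sub>R * card S\<^sub>C))
                        * sigma1 (submatrix A S\<^sub>R S\<^sub>C)))
        (pair_pmf (random_subset_pmf n (min 1 (k / real n)))
                  (random_subset_pmf m (min 1 (k / real m)))))"

definition sample_size :: "real \<Rightarrow> nat \<Rightarrow> nat \<Rightarrow> real \<Rightarrow> real" where
  "sample_size C n m \<epsilon> =
     max (C * max ((ln (real n))\<^sup>2) ((ln (real m))\<^sup>2) / \<epsilon>\<^sup>2)
         ((1 / \<epsilon>) powr (C / \<epsilon>\<^sup>2))"

end

theory Submission
  imports Defs "Jordan_Normal_Form.Spectral_Radius"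
begin

text \<open>
  Keeping each row with probability \<open>p\<close> and rescaling by \<open>1/p\<close> gives an unbiased estimate of the Gram
  matrix \<open>A\<^sup>T A\<close>. Every entry of it is a sum of \<open>n\<close> independent terms of size at most \<open>L\<^sup>2/p\<close>, so the
  expected squared Frobenius error is at most \<open>n\<^sup>2 m\<^sup>2 L\<^sup>4 / k\<close>, and it bounds the error of the squared top
  singular value. Applying this to the rows and then, after transposing, to the columns,
  Chebyshev's inequality yields \<open>\<bar>\<sigma>\<^sub>1(A)\<^sup>2 - z\<^sup>2\<bar> \<le> \<epsilon>\<^sup>2 L\<^sup>2 n m\<close> as soon as \<open>k\<close> is at least
  a large constant times \<open>\<epsilon>\<^sup>-\<^sup>4\<close>. Since \<open>\<bar>x - y\<bar>\<^sup>2 \<le> \<bar>x\<^sup>2 - y\<^sup>2\<bar>\<close> for nonnegative \<open>x\<close> and \<open>y\<close>, this suffices.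
  The prescribed sample size is that large unless \<open>n = m = 1\<close>, when nothing is lost by sampling.
\<close>

section \<open>The largest singular value as an operator norm\<close>

lemma finite_singular_values: "finite (singular_values M)"
proof -
  have "transpose_mat M * M \<in> carrier_mat (dim_col M) (dim_col M)" by auto
  from card_finite_spectrum(1)[OF this] show ?thesis
    unfolding spectrum_def singular_values_def by (simp add: setcompr_eq_image)
qed

lemma sigma1_nonneg: "0 \<le> sigma1 M"
  unfolding sigma1_def using finite_singular_values by (intro Max_ge) auto

lemma singular_value_le_sigma1: "eigenvalue (transpose_mat M * M) l \<Longrightarrow> sqrt l \<le> sigma1 M"
  unfolding sigma1_def using finite_singular_values
  by (intro Max_ge) (auto simp: singular_values_def)

lemma sigma1_cases:
  obtains "sigma1 M = 0" | l where "eigenvalue (transpose_mat M * M) l" "sigma1 M = sqrt l"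
proof -
  have "sigma1 M \<in> insert 0 (singular_values M)"
    unfolding sigma1_def using finite_singular_values by (intro Max_in) auto
  then show thesis using that by (auto simp: singular_values_def)
qed

lemma sum_square_eq_0_iff:
  fixes x :: "nat \<Rightarrow> real"
  shows "(\<Sum>j<m. (x j)\<^sup>2) = 0 \<longleftrightarrow> (\<forall>j<m. x j = 0)"
  by (subst sum_nonneg_eq_0_iff) auto

text \<open>Cauchy-Schwarz in each row, then summed over the rows. This crude operator norm bound is
  used for an inverse matrix, for the error of the Gram matrix and for \<open>sigma1\<close>
  itself.\<close>

lemma mat_vec_norm_le_frobenius:
  fixes a :: "nat \<Rightarrow> nat \<Rightarrow> real"
  shows "(\<Sum>i<n. (\<Sum>j<m. a i j * x j)\<^sup>2) \<le> (\<Sum>i<n. \<Sum>j<m. (a i j)\<^sup>2) * (\<Sum>j<m. (x j)\<^sup>2)"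
  unfolding sum_distrib_right
  by (intro sum_mono order.trans[OF Cauchy_Schwarz_ineq_sum]) (simp add: sum_distrib_right)

lemma sum_adjoint:
  fixes a :: "nat \<Rightarrow> nat \<Rightarrow> real"
  shows "(\<Sum>i<n. (\<Sum>j<m. a i j * x j) * y i) = (\<Sum>j<m. x j * (\<Sum>i<n. a i j * y i))"
  unfolding sum_distrib_right sum_distrib_left
  by (subst sum.swap) (simp add: mult_ac)

lemma gram_mult_vec_index:
  assumes "A \<in> carrier_mat n m" "v \<in> carrier_vec m" "j < m"
  shows "vec_index (transpose_mat A * A *\<^sub>v v) j =
    (\<Sum>i<n. A $$ (i, j) * (\<Sum>l<m. A $$ (i, l) * vec_index v l))"
proof -
  have "transpose_mat A * A *\<^sub>v v = transpose_mat A *\<^sub>v (A *\<^sub>v v)"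
    using assms by (intro assoc_mult_mat_vec) auto
  then show ?thesis
    using assms by (simp add: scalar_prod_def lessThan_atLeast0)
qed

text \<open>An eigenvector \<open>v\<close> of the Gram matrix with eigenvalue \<open>l\<close>
  satisfies |Av|^2 = l |v|^2, so the assumed bound at \<open>v\<close> forces
  \<open>l \<le> c\<close>. Vectors are plain functions here, of which only the values below
  \<open>m\<close> matter.\<close>

lemma sigma1_square_le:
  assumes A: "A \<in> carrier_mat n m" and c: "0 \<le> c"
    and le: "\<And>x. (\<Sum>i<n. (\<Sum>j<m. A $$ (i, j) * x j)\<^sup>2) \<le> c * (\<Sum>j<m. (x j)\<^sup>2)"
  shows "(sigma1 A)\<^sup>2 \<le> c"
proof (rule sigma1_cases[of A])
  assume "sigma1 A = 0"
  then show ?thesis using c by simp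
next
  fix l assume l: "eigenvalue (transpose_mat A * A) l" and s: "sigma1 A = sqrt l"
  from l obtain v where v: "v \<in> carrier_vec m" "v \<noteq> 0\<^sub>v m"
    and ev: "transpose_mat A * A *\<^sub>v v = l \<cdot>\<^sub>v v"
    using A unfolding eigenvalue_def eigenvector_def by auto
  define x where "x = vec_index v"
  have eq: "(\<Sum>i<n. A $$ (i, j) * (\<Sum>l<m. A $$ (i, l) * x l)) = l * x j" if "j < m" for j
    using gram_mult_vec_index[OF A v(1) that] that v(1) unfolding ev x_def by simp
  have "(\<Sum>i<n. (\<Sum>j<m. A $$ (i, j) * x j)\<^sup>2)
      = (\<Sum>j<m. x j * (\<Sum>i<n. A $$ (i, j) * (\<Sum>l<m. A $$ (i, l) * x l)))"
    unfolding power2_eq_square by (rule sum_adjoint)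
  also have "\<dots> = (\<Sum>j<m. l * (x j)\<^sup>2)"
    by (intro sum.cong) (auto simp: eq power2_eq_square)
  finally have Q: "(\<Sum>i<n. (\<Sum>j<m. A $$ (i, j) * x j)\<^sup>2) = l * (\<Sum>j<m. (x j)\<^sup>2)"
    by (simp add: sum_distrib_left)
  have "\<exists>j<m. x j \<noteq> 0" using v unfolding x_def by (auto intro!: eq_vecI)
  then have "(\<Sum>j<m. (x j)\<^sup>2) \<noteq> 0" by (auto simp: sum_square_eq_0_iff)
  then have pos: "(\<Sum>j<m. (x j)\<^sup>2) > 0" by (simp add: sum_nonneg order_less_le)
  have "l \<le> c" using le[of x] pos unfolding Q by simp
  \<comment> \<open>The sign of \<open>l\<close> matters because \<open>sqrt\<close> is also defined
    on negative reals, where its square is not \<open>l\<close>.\<close>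
  moreover have "0 \<le> l * (\<Sum>j<m. (x j)\<^sup>2)" unfolding Q[symmetric] by (simp add: sum_nonneg)
  then have "0 \<le> l" using pos by (simp add: zero_le_mult_iff)
  ultimately show ?thesis using s by simp
qed

text \<open>A non-eigenvalue \<open>l\<close> makes \<open>H = l I - G\<close> invertible. With
  inverse \<open>W\<close>, v = W (H v), and \<open>K\<close> is the squared Frobenius norm of
  \<open>W\<close>.\<close>

lemma not_eigenvalue_coercive:
  fixes G :: "real mat"
  assumes G: "G \<in> carrier_mat m m" and ne: "\<not> eigenvalue G l"
  obtains K where "K \<ge> 0"
    "\<And>v. v \<in> carrier_vec m \<Longrightarrow>
      (\<Sum>j<m. (vec_index v j)\<^sup>2) \<le> K * (\<Sum>j<m. (l * vec_index v j - vec_index (G *\<^sub>v v) j)\<^sup>2)"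
proof -
  define H where "H = l \<cdot>\<^sub>m 1\<^sub>m m - G"
  have H: "H \<in> carrier_mat m m" using G unfolding H_def by auto
  have Hv: "H *\<^sub>v v = l \<cdot>\<^sub>v v - G *\<^sub>v v" if "v \<in> carrier_vec m" for v
    using that G unfolding H_def
    by (subst minus_mult_distrib_mat_vec[where nr=m and nc=m]) auto
  have "det H \<noteq> 0"
  proof
    assume "det H = 0"
    then obtain v where v: "v \<in> carrier_vec m" "v \<noteq> 0\<^sub>v m" "H *\<^sub>v v = 0\<^sub>v m"
      using det_0_iff_vec_prod_zero[OF H] by auto
    have "G *\<^sub>v v = l \<cdot>\<^sub>v v"
    proof (rule eq_vecI)
      fix i assume i: "i < dim_vec (l \<cdot>\<^sub>v v)"
      have "vec_index (l \<cdot>\<^sub>v v - G *\<^sub>v v) i = 0"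
        using v i unfolding Hv[OF v(1), symmetric] by simp
      then show "vec_index (G *\<^sub>v v) i = vec_index (l \<cdot>\<^sub>v v) i" using i v G by simp
    qed (use v G in auto)
    then have "eigenvector G v l" using v G unfolding eigenvector_def by auto
    then show False using ne unfolding eigenvalue_def by auto
  qed
  from det_non_zero_imp_unit[OF H this, of "()"]
  obtain W where W: "W \<in> carrier_mat m m" "W * H = 1\<^sub>m m"
    by (auto simp: Units_def ring_mat_def)
  show thesis
  proof
    show "0 \<le> (\<Sum>i<m. \<Sum>j<m. (W $$ (i, j))\<^sup>2)" by (simp add: sum_nonneg)
    fix v :: "real vec" assume v: "v \<in> carrier_vec m"
    have "v = W *\<^sub>v (H *\<^sub>v v)"
      using assoc_mult_mat_vec[OF W(1) H v] W(2) v by simp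
    then have "vec_index v i = vec_index (W *\<^sub>v (H *\<^sub>v v)) i" for i by simp
    moreover have "vec_index (W *\<^sub>v u) i = (\<Sum>j<m. W $$ (i, j) * vec_index u j)"
      if "i < m" "u \<in> carrier_vec m" for i u
      using that W by (simp add: scalar_prod_def lessThan_atLeast0)
    ultimately have "vec_index v i = (\<Sum>j<m. W $$ (i, j) * vec_index (H *\<^sub>v v) j)" if "i < m" for i
      using that H v by (metis mult_mat_vec_carrier)
    then have "(\<Sum>i<m. (vec_index v i)\<^sup>2)
        = (\<Sum>i<m. (\<Sum>j<m. W $$ (i, j) * vec_index (H *\<^sub>v v) j)\<^sup>2)" by simp
    also have "\<dots> \<le> (\<Sum>i<m. \<Sum>j<m. (W $$ (i, j))\<^sup>2) * (\<Sum>j<m. (vec_index (H *\<^sub>v v) j)\<^sup>2)"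
      by (rule mat_vec_norm_le_frobenius)
    also have "(\<Sum>j<m. (vec_index (H *\<^sub>v v) j)\<^sup>2)
        = (\<Sum>j<m. (l * vec_index v j - vec_index (G *\<^sub>v v) j)\<^sup>2)"
      using v G by (intro sum.cong) (auto simp: Hv)
    finally show "(\<Sum>j<m. (vec_index v j)\<^sup>2) \<le> (\<Sum>i<m. \<Sum>j<m. (W $$ (i, j))\<^sup>2)
        * (\<Sum>j<m. (l * vec_index v j - vec_index (G *\<^sub>v v) j)\<^sup>2)" .
  qed
qed

text \<open>
  If the supremum \<open>s\<close> of the Rayleigh quotient of \<open>A\<^sup>T A\<close> were not an eigenvalue, then
  \<open>H = s I - A\<^sup>T A\<close> would be invertible. Testing the nonnegative form \<open>x \<bullet> H x\<close> at
  \<open>x - (1/s) H x\<close> gives \<open>\<bar>H x\<bar>\<^sup>2 \<le> s (x \<bullet> H x)\<close>, so \<open>x \<bullet> H x\<close> would be bounded away from \<open>0\<close> on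
  the unit sphere, contradicting the choice of \<open>s\<close>.
\<close>

lemma rayleigh_sup_eigenvalue:
  fixes A :: "real mat"
  assumes A: "A \<in> carrier_mat n m" and m: "m > 0"
  defines "Q \<equiv> \<lambda>x. \<Sum>i<n. (\<Sum>j<m. A $$ (i, j) * x j)\<^sup>2"
  defines "s \<equiv> Sup (Q ` {x. (\<Sum>j<m. (x j)\<^sup>2) = 1})"
  shows "eigenvalue (transpose_mat A * A) s" and "Q x \<le> s * (\<Sum>j<m. (x j)\<^sup>2)" and "s \<ge> 0"
proof -
  define U where "U = {x :: nat \<Rightarrow> real. (\<Sum>j<m. (x j)\<^sup>2) = 1}"
  have bdd: "bdd_above (Q ` U)"
  proof (rule bdd_aboveI2)
    fix x assume "x \<in> U"
    then show "Q x \<le> (\<Sum>i<n. \<Sum>j<m. (A $$ (i, j))\<^sup>2)"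
      using mat_vec_norm_le_frobenius[where n=n and m=m and a="\<lambda>i j. A $$ (i, j)" and x=x]
      unfolding U_def Q_def by simp
  qed
  \<comment> \<open>The first unit vector exists because \<open>m > 0\<close>; it keeps the supremum
    from ranging over an empty set.\<close>
  have e0: "(\<lambda>j. if j = 0 then 1 else 0) \<in> U"
    using m unfolding U_def by (simp add: if_distrib[of "\<lambda>x. x\<^sup>2"] cong: if_cong)
  have unit: "Q x \<le> s" if "x \<in> U" for x
    using bdd that unfolding s_def U_def by (intro cSUP_upper) auto
  have Q0: "Q x \<ge> 0" for x unfolding Q_def by (simp add: sum_nonneg)
  show s0: "s \<ge> 0" using unit[OF e0] Q0 by (meson order.trans)
  have Qs: "Q (\<lambda>j. t * x j) = t\<^sup>2 * Q x" for t x
    unfolding Q_def by (simp add: sum_distrib_left power_mult_distrib[symmetric] mult_ac)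
  have ray: "Q x \<le> s * (\<Sum>j<m. (x j)\<^sup>2)" for x
  proof (cases "(\<Sum>j<m. (x j)\<^sup>2) = 0")
    case True
    then have "\<forall>j<m. x j = 0" by (simp add: sum_square_eq_0_iff)
    then have "Q x = 0" unfolding Q_def by simp
    then show ?thesis using True by simp
  next
    case False
    define N where "N = (\<Sum>j<m. (x j)\<^sup>2)"
    have N: "N > 0" using False unfolding N_def by (simp add: sum_nonneg order_less_le)
    have "(\<lambda>j. (1 / sqrt N) * x j) \<in> U" unfolding U_def
      using N by (simp add: power_mult_distrib power_divide sum_divide_distrib[symmetric] N_def[symmetric])
    from unit[OF this] have "Q x / N \<le> s" unfolding Qs using N by (simp add: power_divide)
    then show ?thesis using N unfolding N_def[symmetric] by (simp add: field_simps)
  qed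
  then show "Q x \<le> s * (\<Sum>j<m. (x j)\<^sup>2)" .
  show "eigenvalue (transpose_mat A * A) s"
  proof (rule ccontr)
    assume "\<not> eigenvalue (transpose_mat A * A) s"
    moreover have G: "transpose_mat A * A \<in> carrier_mat m m" using A by auto
    ultimately obtain K where K: "K \<ge> 0" and coer: "\<And>v. v \<in> carrier_vec m \<Longrightarrow>
      (\<Sum>j<m. (vec_index v j)\<^sup>2)
        \<le> K * (\<Sum>j<m. (s * vec_index v j - vec_index (transpose_mat A * A *\<^sub>v v) j)\<^sup>2)"
      using not_eigenvalue_coercive by blast
    define M where "M = (\<lambda>x i. \<Sum>j<m. A $$ (i, j) * x j)"
    define h where "h = (\<lambda>x j. s * x j - (\<Sum>i<n. A $$ (i, j) * M x i))"
    have QM: "Q x = (\<Sum>i<n. (M x i)\<^sup>2)" for x unfolding Q_def M_def ..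
    have coer': "(\<Sum>j<m. (x j)\<^sup>2) \<le> K * (\<Sum>j<m. (h x j)\<^sup>2)" for x
    proof -
      have "vec m x \<in> carrier_vec m" by simp
      from coer[OF this] show ?thesis
        by (simp add: gram_mult_vec_index[OF A] h_def M_def del: index_mult_mat_vec)
    qed
    have main: "(\<Sum>j<m. (h x j)\<^sup>2) \<le> s * (s * (\<Sum>j<m. (x j)\<^sup>2) - Q x)" for x
    proof -
      define y where "y = h x"
      define N where "N = (\<Sum>j<m. (y j)\<^sup>2)"
      \<comment> \<open>The left side is the bilinear form of \<open>H\<close> at \<open>x\<close>
        and \<open>y\<close>; by symmetry it is the inner product of \<open>H x\<close> with
        \<open>y\<close>, and \<open>y = H x\<close>.\<close>
      have cross: "s * (\<Sum>j<m. x j * y j) - (\<Sum>i<n. M x i * M y i) = N"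
      proof -
        have "(\<Sum>i<n. M y i * M x i) = (\<Sum>j<m. y j * (\<Sum>i<n. A $$ (i, j) * M x i))"
          unfolding M_def by (rule sum_adjoint)
        moreover have "N = (\<Sum>j<m. y j * (s * x j - (\<Sum>i<n. A $$ (i, j) * M x i)))"
          unfolding N_def y_def h_def by (simp add: power2_eq_square)
        ultimately show ?thesis
          by (simp add: right_diff_distrib sum_subtractf sum_distrib_left mult_ac)
      qed
      have Mlin: "M (\<lambda>j. s * x j - y j) i = s * M x i - M y i" for i
        unfolding M_def by (simp add: right_diff_distrib sum_subtractf sum_distrib_left mult_ac)
      \<comment> \<open>The test vector is multiplied by \<open>s\<close>, so that the expansion is
        also valid for \<open>s = 0\<close>.\<close>
      have "Q (\<lambda>j. s * x j - y j) \<le> s * (\<Sum>j<m. (s * x j - y j)\<^sup>2)" by (rule ray)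
      also have "(\<Sum>j<m. (s * x j - y j)\<^sup>2) = s\<^sup>2 * (\<Sum>j<m. (x j)\<^sup>2) - 2 * s * (\<Sum>j<m. x j * y j) + N"
        unfolding N_def power2_diff
        by (simp add: sum.distrib sum_subtractf sum_distrib_left power_mult_distrib mult_ac)
      also have "Q (\<lambda>j. s * x j - y j) = s\<^sup>2 * Q x - 2 * s * (\<Sum>i<n. M x i * M y i) + Q y"
        unfolding QM Mlin power2_diff
        by (simp add: sum.distrib sum_subtractf sum_distrib_left power_mult_distrib mult_ac)
      finally have "0 \<le> s * (s\<^sup>2 * (\<Sum>j<m. (x j)\<^sup>2)) - s\<^sup>2 * Q x
          - 2 * s * (s * (\<Sum>j<m. x j * y j) - (\<Sum>i<n. M x i * M y i)) + (s * N - Q y)"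
        by (simp add: algebra_simps)
      then have "0 \<le> s * (s * (s * (\<Sum>j<m. (x j)\<^sup>2) - Q x) - N) - Q y"
        unfolding cross by (simp add: algebra_simps power2_eq_square)
      then have *: "0 \<le> s * (s * (s * (\<Sum>j<m. (x j)\<^sup>2) - Q x) - N)" using Q0[of y] by linarith
      show ?thesis
      \<comment> \<open>No factor \<open>s\<close> can be cancelled when \<open>s = 0\<close>; then
        \<open>Q\<close> vanishes identically, and with it \<open>M x\<close> and
        \<open>h x\<close>.\<close>
      proof (cases "s = 0")
        case True
        have Qz: "Q x = 0" for x using ray[of x] Q0[of x] True by simp
        have "M x i = 0" if "i < n" for i
          using Qz[of x] that unfolding QM by (simp add: sum_square_eq_0_iff)
        then have "h x j = 0" for j unfolding h_def using True by simp
        then show ?thesis using True by simp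
      next
        case False
        with s0 * have "0 \<le> s * (s * (\<Sum>j<m. (x j)\<^sup>2) - Q x) - N"
          by (simp add: zero_le_mult_iff)
        then show ?thesis unfolding N_def y_def by simp
      qed
    qed
    have gap: "1 \<le> K * s * (s - Q x)" if "x \<in> U" for x
    proof -
      have "1 \<le> K * (\<Sum>j<m. (h x j)\<^sup>2)" using coer'[of x] that unfolding U_def by simp
      also have "\<dots> \<le> K * (s * (s * (\<Sum>j<m. (x j)\<^sup>2) - Q x))" using K main by (intro mult_left_mono)
      finally show ?thesis using that unfolding U_def by (simp add: mult_ac)
    qed
    have Ks: "K * s > 0" using gap[OF e0] K s0 by (cases "K * s = 0") (auto simp: order_less_le)
    \<comment> \<open>By \<open>gap\<close>, every unit vector stays at least
      \<open>1 / (K * s)\<close> below \<open>s\<close>, a margin independent of the vector, so the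
      supremum does too.\<close>
    have "s \<le> s - 1 / (K * s)"
      unfolding s_def U_def[symmetric]
    proof (rule cSUP_least)
      show "U \<noteq> {}" using e0 by auto
      fix x assume "x \<in> U"
      from gap[OF this] have "1 / (K * s) \<le> s - Q x"
        using Ks by (subst pos_divide_le_eq) (auto simp: mult_ac)
      then show "Q x \<le> Sup (Q ` U) - 1 / (K * Sup (Q ` U))"
        unfolding s_def U_def[symmetric] by simp
    qed
    then show False using Ks by simp
  qed
qed

text \<open>Converse of \<open>sigma1_square_le\<close>: the supremum of the Rayleigh quotient is an
  eigenvalue, so its root is a singular value and at most \<open>sigma1 A\<close>. Without columns
  there are no unit vectors, but both sides are \<open>0\<close>.\<close>

lemma mat_vec_norm_le_sigma1:
  assumes A: "A \<in> carrier_mat n m"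
  shows "(\<Sum>i<n. (\<Sum>j<m. A $$ (i, j) * x j)\<^sup>2) \<le> (sigma1 A)\<^sup>2 * (\<Sum>j<m. (x j)\<^sup>2)"
proof (cases "m = 0")
  case False
  then have m: "m > 0" by simp
  define s where
    "s = Sup ((\<lambda>x. \<Sum>i<n. (\<Sum>j<m. A $$ (i, j) * x j)\<^sup>2) ` {x. (\<Sum>j<m. (x j)\<^sup>2) = 1})"
  note r = rayleigh_sup_eigenvalue[OF A m, folded s_def]
  have "sqrt s \<le> sigma1 A" by (rule singular_value_le_sigma1[OF r(1)])
  then have "s \<le> (sigma1 A)\<^sup>2" by (rule sqrt_le_D)
  then show ?thesis
    by (intro order.trans[OF r(2)] mult_right_mono) (auto simp: sum_nonneg)
qed simp

lemma sigma1_square_le_frobenius: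
  assumes "A \<in> carrier_mat n m"
  shows "(sigma1 A)\<^sup>2 \<le> (\<Sum>i<n. \<Sum>j<m. (A $$ (i, j))\<^sup>2)"
  using assms mat_vec_norm_le_frobenius by (intro sigma1_square_le) (auto simp: sum_nonneg)

text \<open>\<open>M\<close> maps an eigenvector of \<open>transpose_mat M * M\<close> to one of
  \<open>M * transpose_mat M\<close> with the same eigenvalue. The image is nonzero when
  \<open>l\<close> is; an eigenvalue \<open>0\<close> only contributes the singular value
  \<open>0\<close>.\<close>

lemma sigma1_transpose_le: "sigma1 M \<le> sigma1 (transpose_mat M)"
proof (rule sigma1_cases[of M])
  assume "sigma1 M = 0"
  then show ?thesis using sigma1_nonneg by simp
next
  fix l assume l: "eigenvalue (transpose_mat M * M) l" and s: "sigma1 M = sqrt l"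
  define n m where "n = dim_row M" and "m = dim_col M"
  have M: "M \<in> carrier_mat n m" and Mt: "transpose_mat M \<in> carrier_mat m n"
    unfolding n_def m_def by auto
  from l obtain v where v: "v \<in> carrier_vec m" "v \<noteq> 0\<^sub>v m"
    and ev: "transpose_mat M * M *\<^sub>v v = l \<cdot>\<^sub>v v"
    using M unfolding eigenvalue_def eigenvector_def by auto
  show ?thesis
  proof (cases "l = 0")
    case True
    then show ?thesis using s sigma1_nonneg by simp
  next
    case False
    have ev': "transpose_mat M *\<^sub>v (M *\<^sub>v v) = l \<cdot>\<^sub>v v"
      using ev assoc_mult_mat_vec[OF Mt M v(1)] by simp
    have Mv: "M *\<^sub>v v \<in> carrier_vec n" using M v by auto
    have "M *\<^sub>v v \<noteq> 0\<^sub>v n"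
    proof
      assume "M *\<^sub>v v = 0\<^sub>v n"
      then have "l \<cdot>\<^sub>v v = 0\<^sub>v m"
        unfolding ev'[symmetric] using M by (auto intro!: eq_vecI simp: scalar_prod_def)
      then have "v = 0\<^sub>v m" using False v(1) by (auto simp: vec_eq_iff)
      then show False using v by simp
    qed
    moreover have "M * transpose_mat M *\<^sub>v (M *\<^sub>v v) = l \<cdot>\<^sub>v (M *\<^sub>v v)"
      using assoc_mult_mat_vec[OF M Mt Mv] ev' mult_mat_vec[OF M v(1)] by simp
    ultimately have "eigenvalue (M * transpose_mat M) l"
      using Mv M unfolding eigenvalue_def eigenvector_def by auto
    then show ?thesis using s singular_value_le_sigma1[of "transpose_mat M" l] by simp
  qed
qed

lemma sigma1_transpose: "sigma1 (transpose_mat M) = sigma1 M"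
  using sigma1_transpose_le[of M] sigma1_transpose_le[of "transpose_mat M"] by simp

section \<open>Submatrices\<close>

text \<open>Lets sums over the row positions of a submatrix be rewritten as sums over the selected
  rows of the original matrix.\<close>

lemma bij_betw_pick: "finite S \<Longrightarrow> bij_betw (pick S) {..<card S} S"
proof -
  assume S: "finite S"
  have inj: "inj_on (pick S) {..<card S}"
    using pick_mono_le[of _ S] by (intro linorder_inj_onI) (auto simp: less_le)
  moreover have "pick S ` {..<card S} = S"
    using pick_in_set_le[of _ S] inj S by (intro card_subset_eq) (auto simp: card_image)
  ultimately show ?thesis by (simp add: bij_betw_def)
qed

lemma row_submatrix:
  assumes "A \<in> carrier_mat n m" "S \<subseteq> {..<n}"
  shows "submatrix A S UNIV \<in> carrier_mat (card S) m"
    and "\<And>i j. i < card S \<Longrightarrow> j < m \<Longrightarrow> submatrix A S UNIV $$ (i, j) = A $$ (pick S i, j)"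
proof -
  have S: "{i. i < dim_row A \<and> i \<in> S} = S" using assms by auto
  show "submatrix A S UNIV \<in> carrier_mat (card S) m"
    using assms(1) by (intro carrier_matI) (simp_all only: dim_submatrix S, simp)
  fix i j assume "i < card S" "j < m"
  then show "submatrix A S UNIV $$ (i, j) = A $$ (pick S i, j)"
    using assms(1) by (subst submatrix_index) (simp_all only: S pick_UNIV, simp)
qed

text \<open>Selecting columns is selecting rows of the transpose, so the analysis of row sampling
  can be applied twice.\<close>

lemma submatrix_rows_columns:
  assumes A: "A \<in> carrier_mat n m" and S: "S \<subseteq> {..<n}" and T: "T \<subseteq> {..<m}"
  shows "submatrix A S T =
    transpose_mat (submatrix (transpose_mat (submatrix A S UNIV)) T UNIV)"
proof (rule eq_matI)
  define B where "B = transpose_mat (submatrix A S UNIV)"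
  have B: "B \<in> carrier_mat m (card S)" using row_submatrix(1)[OF A S] unfolding B_def by simp
  note C = row_submatrix[OF B T, unfolded B_def]
  have ST: "{i. i < dim_row A \<and> i \<in> S} = S" "{j. j < dim_col A \<and> j \<in> T} = T"
    using A S T by auto
  fix i j assume "i < dim_row (transpose_mat (submatrix (transpose_mat (submatrix A S UNIV)) T UNIV))"
    "j < dim_col (transpose_mat (submatrix (transpose_mat (submatrix A S UNIV)) T UNIV))"
  then have ij: "i < card S" "j < card T" using C(1) by auto
  have "pick T j \<in> T" by (rule pick_in_set_le[OF ij(2)])
  then have "pick T j < m" using T by auto
  then show "submatrix A S T $$ (i, j) =
      transpose_mat (submatrix (transpose_mat (submatrix A S UNIV)) T UNIV) $$ (i, j)"
    using ij C row_submatrix[OF A S] ST by (subst submatrix_index) (auto)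
next
  have "{i. i < n \<and> i \<in> S} = S" "{j. j < m \<and> j \<in> T} = T" using S T by auto
  then show "dim_row (submatrix A S T) =
      dim_row (transpose_mat (submatrix (transpose_mat (submatrix A S UNIV)) T UNIV))"
    "dim_col (submatrix A S T) =
      dim_col (transpose_mat (submatrix (transpose_mat (submatrix A S UNIV)) T UNIV))"
    using A by (simp_all add: dim_submatrix)
qed

section \<open>Perturbation of \<open>sigma1\<close> under row selection\<close>

text \<open>Writes the squared norm as the quadratic form of the Gram matrix of the rows in
  \<open>S\<close>, so that comparing two such norms reduces to comparing Gram matrices entry by
  entry.\<close>

lemma quadratic_form_expand:
  fixes a :: "nat \<Rightarrow> nat \<Rightarrow> real"
  shows "(\<Sum>i\<in>S. (\<Sum>j<m. a i j * x j)\<^sup>2) = (\<Sum>j<m. x j * (\<Sum>l<m. (\<Sum>i\<in>S. a i j * a i l) * x l))"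
proof -
  have "(\<Sum>i\<in>S. (\<Sum>j<m. a i j * x j)\<^sup>2)
      = (\<Sum>i\<in>S. \<Sum>j<m. \<Sum>l<m. x j * (a i j * a i l * x l))"
    unfolding power2_eq_square sum_product by (simp add: mult_ac)
  also have "\<dots> = (\<Sum>j<m. \<Sum>i\<in>S. \<Sum>l<m. x j * (a i j * a i l * x l))" by (rule sum.swap)
  also have "\<dots> = (\<Sum>j<m. \<Sum>l<m. \<Sum>i\<in>S. x j * (a i j * a i l * x l))"
    by (intro sum.cong refl sum.swap)
  finally show ?thesis by (simp add: sum_distrib_left sum_distrib_right)
qed

lemma quadratic_form_le_frobenius:
  fixes e :: "nat \<Rightarrow> nat \<Rightarrow> real"
  assumes "(\<Sum>j<m. \<Sum>l<m. (e j l)\<^sup>2) \<le> D\<^sup>2" "0 \<le> D"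
  shows "\<bar>\<Sum>j<m. x j * (\<Sum>l<m. e j l * x l)\<bar> \<le> D * (\<Sum>j<m. (x j)\<^sup>2)"
proof -
  have N: "0 \<le> (\<Sum>j<m. (x j)\<^sup>2)" by (simp add: sum_nonneg)
  have "(\<Sum>j<m. x j * (\<Sum>l<m. e j l * x l))\<^sup>2
      \<le> (\<Sum>j<m. (x j)\<^sup>2) * (\<Sum>j<m. (\<Sum>l<m. e j l * x l)\<^sup>2)"
    by (rule Cauchy_Schwarz_ineq_sum)
  also have "\<dots> \<le> (\<Sum>j<m. (x j)\<^sup>2) * ((\<Sum>j<m. \<Sum>l<m. (e j l)\<^sup>2) * (\<Sum>j<m. (x j)\<^sup>2))"
    by (intro mult_left_mono mat_vec_norm_le_frobenius N)
  also have "\<dots> \<le> (\<Sum>j<m. (x j)\<^sup>2) * (D\<^sup>2 * (\<Sum>j<m. (x j)\<^sup>2))"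
    by (intro mult_left_mono mult_right_mono N assms)
  also have "\<dots> = (D * (\<Sum>j<m. (x j)\<^sup>2))\<^sup>2" by (simp add: power2_eq_square)
  finally show ?thesis using assms(2) N by (simp add: abs_le_square_iff[symmetric])
qed

text \<open>The squared \<open>sigma1\<close> is the best constant in the bound of |Ax|^2 by |x|^2.
  The rescaled and the full quadratic forms differ by at most D |x|^2, so these best constants
  differ by at most \<open>D\<close>.\<close>

lemma sigma1_row_perturbation:
  assumes A: "A \<in> carrier_mat n m" and S: "S \<subseteq> {..<n}" and p: "0 < p" and D: "0 \<le> D"
    and F: "(\<Sum>j<m. \<Sum>l<m. ((\<Sum>i\<in>S. A $$ (i, j) * A $$ (i, l)) / p
              - (\<Sum>i<n. A $$ (i, j) * A $$ (i, l)))\<^sup>2) \<le> D\<^sup>2"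
  shows "\<bar>(sigma1 (submatrix A S UNIV))\<^sup>2 / p - (sigma1 A)\<^sup>2\<bar> \<le> D"
proof -
  define B where "B = submatrix A S UNIV"
  have B: "B \<in> carrier_mat (card S) m" unfolding B_def by (rule row_submatrix[OF A S])
  have QB: "(\<Sum>i<card S. (\<Sum>j<m. B $$ (i, j) * x j)\<^sup>2) = (\<Sum>i\<in>S. (\<Sum>j<m. A $$ (i, j) * x j)\<^sup>2)" for x
  proof -
    have "(\<Sum>i<card S. (\<Sum>j<m. B $$ (i, j) * x j)\<^sup>2)
        = (\<Sum>i<card S. (\<Sum>j<m. A $$ (pick S i, j) * x j)\<^sup>2)"
      unfolding B_def by (intro sum.cong refl) (simp add: row_submatrix(2)[OF A S])
    also have "\<dots> = (\<Sum>i\<in>S. (\<Sum>j<m. A $$ (i, j) * x j)\<^sup>2)"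
      using S finite_subset by (intro sum.reindex_bij_betw bij_betw_pick) blast
    finally show ?thesis .
  qed
  have lin: "(\<Sum>j<m. x j * (\<Sum>l<m. g j l * x l)) / p - (\<Sum>j<m. x j * (\<Sum>l<m. h j l * x l))
      = (\<Sum>j<m. x j * (\<Sum>l<m. (g j l / p - h j l) * x l))" for g h and x :: "nat \<Rightarrow> real"
    by (simp add: sum_divide_distrib sum_distrib_left sum_subtractf[symmetric])
      (intro sum.cong refl, simp add: algebra_simps)
  have dev: "\<bar>(\<Sum>i\<in>S. (\<Sum>j<m. A $$ (i, j) * x j)\<^sup>2) / p - (\<Sum>i<n. (\<Sum>j<m. A $$ (i, j) * x j)\<^sup>2)\<bar>
      \<le> D * (\<Sum>j<m. (x j)\<^sup>2)" for x
  proof -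
    have "(\<Sum>i\<in>S. (\<Sum>j<m. A $$ (i, j) * x j)\<^sup>2) / p - (\<Sum>i<n. (\<Sum>j<m. A $$ (i, j) * x j)\<^sup>2)
      = (\<Sum>j<m. x j * (\<Sum>l<m. ((\<Sum>i\<in>S. A $$ (i, j) * A $$ (i, l)) / p
              - (\<Sum>i<n. A $$ (i, j) * A $$ (i, l))) * x l))"
      unfolding quadratic_form_expand by (rule lin)
    then show ?thesis using quadratic_form_le_frobenius[OF F D, of x] by simp
  qed
  have "(sigma1 A)\<^sup>2 \<le> (sigma1 B)\<^sup>2 / p + D"
  proof (rule sigma1_square_le[OF A])
    show "0 \<le> (sigma1 B)\<^sup>2 / p + D" using p D by simp
    fix x
    have "(\<Sum>i\<in>S. (\<Sum>j<m. A $$ (i, j) * x j)\<^sup>2) / p \<le> (sigma1 B)\<^sup>2 * (\<Sum>j<m. (x j)\<^sup>2) / p"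
      using mat_vec_norm_le_sigma1[OF B, of x] p unfolding QB by (intro divide_right_mono) auto
    then show "(\<Sum>i<n. (\<Sum>j<m. A $$ (i, j) * x j)\<^sup>2) \<le> ((sigma1 B)\<^sup>2 / p + D) * (\<Sum>j<m. (x j)\<^sup>2)"
      using dev[of x] by (simp add: distrib_right)
  qed
  moreover have "(sigma1 B)\<^sup>2 \<le> p * ((sigma1 A)\<^sup>2 + D)"
  proof (rule sigma1_square_le[OF B])
    show "0 \<le> p * ((sigma1 A)\<^sup>2 + D)" using p D by simp
    fix x
    have "(\<Sum>i\<in>S. (\<Sum>j<m. A $$ (i, j) * x j)\<^sup>2) / p \<le> ((sigma1 A)\<^sup>2 + D) * (\<Sum>j<m. (x j)\<^sup>2)"
      using dev[of x] mat_vec_norm_le_sigma1[OF A, of x] by (simp add: distrib_right)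
    then show "(\<Sum>i<card S. (\<Sum>j<m. B $$ (i, j) * x j)\<^sup>2) \<le> p * ((sigma1 A)\<^sup>2 + D) * (\<Sum>j<m. (x j)\<^sup>2)"
      unfolding QB using p by (simp add: field_simps)
  qed
  then have "(sigma1 B)\<^sup>2 / p \<le> (sigma1 A)\<^sup>2 + D" using p by (simp add: field_simps)
  ultimately show ?thesis unfolding B_def by (simp add: abs_le_iff)
qed

section \<open>Moments and deviations for random subsets\<close>

lemma finite_random_subset_pmf: "finite (set_pmf (random_subset_pmf n p))"
  and random_subset_pmf_subset: "S \<in> set_pmf (random_subset_pmf n p) \<Longrightarrow> S \<subseteq> {..<n}"
proof -
  show "S \<subseteq> {..<n}" if "S \<in> set_pmf (random_subset_pmf n p)" for S
    using that unfolding random_subset_pmf_def by auto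
  then have "set_pmf (random_subset_pmf n p) \<subseteq> Pow {..<n}" by auto
  then show "finite (set_pmf (random_subset_pmf n p))" by (rule finite_subset) simp
qed

text \<open>The event is a product event: \<open>V\<close> forces the coordinates in
  \<open>T\<close> to \<open>True\<close> and leaves the others free.\<close>

lemma prob_random_subset_superset:
  assumes T: "T \<subseteq> {..<n}" and p: "0 \<le> p" "p \<le> 1"
  shows "measure_pmf.prob (random_subset_pmf n p) {S. T \<subseteq> S} = p ^ card T"
proof -
  define V where "V = (\<lambda>x. if x \<in> T then {True} else UNIV)"
  have "measure_pmf.prob (random_subset_pmf n p) {S. T \<subseteq> S}
      = measure_pmf.prob (Pi_pmf {..<n} False (\<lambda>_. bernoulli_pmf p)) (Pi {..<n} V)"
    unfolding random_subset_pmf_def measure_map_pmf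
    using T by (intro arg_cong[where f="measure_pmf.prob _"]) (auto simp: V_def Pi_def split: if_splits)
  also have "\<dots> = (\<Prod>x<n. measure_pmf.prob (bernoulli_pmf p) (V x))"
    by (rule measure_Pi_pmf_Pi) simp
  also have "\<dots> = (\<Prod>x<n. if x \<in> T then p else 1)"
    using p by (intro prod.cong) (auto simp: V_def measure_pmf_single)
  also have "\<dots> = (\<Prod>x\<in>T. p)"
    using T by (simp add: prod.If_cases Int_absorb1)
  finally show ?thesis by simp
qed

text \<open>The variance of the inverse-probability estimate of a sum: inclusions of distinct
  indices are uncorrelated, so only the diagonal survives. The exact factor \<open>1 / p - 1\<close>
  vanishes for \<open>p = 1\<close>, which settles the case of a dimension not exceeding the sample
  size.\<close>

lemma second_moment_random_subset:
  assumes p: "0 < p" "p \<le> 1"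
  shows "measure_pmf.expectation (random_subset_pmf n p) (\<lambda>S. ((\<Sum>i\<in>S. c i) / p - (\<Sum>i<n. c i))\<^sup>2)
    = (1 / p - 1) * (\<Sum>i<n. (c i)\<^sup>2)"
proof -
  let ?P = "random_subset_pmf n p"
  have int: "integrable ?P f" for f :: "nat set \<Rightarrow> real"
    by (intro integrable_measure_pmf_finite finite_random_subset_pmf)
  have E: "measure_pmf.expectation ?P (\<lambda>S. of_bool (T \<subseteq> S)) = p ^ card T" if "T \<subseteq> {..<n}" for T
  proof -
    have "(\<lambda>S. of_bool (T \<subseteq> S)) = (indicator {S. T \<subseteq> S} :: nat set \<Rightarrow> real)"
      by (auto simp: indicator_def)
    then show ?thesis using prob_random_subset_superset[OF that, of p] p by simp
  qed
  then have E1: "measure_pmf.expectation ?P (\<lambda>S. of_bool ({i} \<subseteq> S)) = p" if "i < n" for i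
    using that E[of "{i}"] by simp
  have E2: "measure_pmf.expectation ?P (\<lambda>S. of_bool ({i, j} \<subseteq> S)) = p ^ card {i, j}"
    if "i < n" "j < n" for i j
    using that by (intro E) auto
  \<comment> \<open>Expanding the square into indicators of supersets reduces the expectation to
    \<open>E1\<close> and \<open>E2\<close>. As \<open>card {i, j}\<close> is 1 for
    \<open>i = j\<close> and 2 otherwise, one formula covers both kinds of terms.\<close>
  have "measure_pmf.expectation ?P (\<lambda>S. ((\<Sum>i\<in>S. c i) / p - (\<Sum>i<n. c i))\<^sup>2)
      = measure_pmf.expectation ?P (\<lambda>S. \<Sum>i<n. \<Sum>j<n. c i * c j *
          (of_bool ({i, j} \<subseteq> S) / p\<^sup>2 - of_bool ({i} \<subseteq> S) / p - of_bool ({j} \<subseteq> S) / p + 1))"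
  proof (intro integral_cong_AE AE_pmfI)
    fix S assume "S \<in> set_pmf ?P"
    then have S: "S \<subseteq> {..<n}" by (rule random_subset_pmf_subset)
    have "(\<Sum>i\<in>S. c i) = (\<Sum>i<n. c i * of_bool (i \<in> S))"
      using S by (simp add: sum.If_cases of_bool_def if_distrib Int_absorb1 cong: if_cong)
    then have "(\<Sum>i\<in>S. c i) / p - (\<Sum>i<n. c i) = (\<Sum>i<n. c i * (of_bool (i \<in> S) / p - 1))"
      by (simp only: sum_divide_distrib sum_subtractf right_diff_distrib) simp
    then show "((\<Sum>i\<in>S. c i) / p - (\<Sum>i<n. c i))\<^sup>2 = (\<Sum>i<n. \<Sum>j<n. c i * c j *
          (of_bool ({i, j} \<subseteq> S) / p\<^sup>2 - of_bool ({i} \<subseteq> S) / p - of_bool ({j} \<subseteq> S) / p + 1))"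
      using p by (simp only: power2_eq_square sum_product)
        (intro sum.cong refl, auto simp: field_simps power2_eq_square)
  qed simp_all
  also have "\<dots> = (\<Sum>i<n. \<Sum>j<n. c i * c j * (p ^ card {i, j} / p\<^sup>2 - 1))"
    using p by (simp add: Bochner_Integration.integral_sum int del: insert_subset)
      (intro sum.cong refl, simp add: E1 E2 del: insert_subset)
  also have "\<dots> = (\<Sum>i<n. \<Sum>j<n. if j = i then (c i)\<^sup>2 * (1 / p - 1) else 0)"
    using p by (intro sum.cong refl) (auto simp: power2_eq_square card_insert_if)
  also have "\<dots> = (1 / p - 1) * (\<Sum>i<n. (c i)\<^sup>2)"
    by (simp add: sum_distrib_left mult_ac)
  finally show ?thesis .
qed

lemma second_moment_random_subset_le:
  assumes "0 < p" "p \<le> 1" "\<And>i. i < n \<Longrightarrow> \<bar>c i\<bar> \<le> M"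
  shows "measure_pmf.expectation (random_subset_pmf n p) (\<lambda>S. ((\<Sum>i\<in>S. c i) / p - (\<Sum>i<n. c i))\<^sup>2)
    \<le> (1 / p - 1) * (real n * M\<^sup>2)"
proof -
  have "(c i)\<^sup>2 \<le> M\<^sup>2" if "i < n" for i
    using power_mono[OF assms(3)[OF that], of 2] by simp
  then have "(\<Sum>i<n. (c i)\<^sup>2) \<le> real n * M\<^sup>2"
    using sum_bounded_above[of "{..<n}" "\<lambda>i. (c i)\<^sup>2" "M\<^sup>2"] by simp
  then show ?thesis unfolding second_moment_random_subset[OF assms(1,2)]
    using assms by (intro mult_left_mono) auto
qed

text \<open>Markov's inequality, phrased for the failure of \<open>f x \<le> t\<close> so that
  failure probabilities can be added up later.\<close>

lemma pmf_markov:
  fixes f :: "'a \<Rightarrow> real"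
  assumes "finite (set_pmf P)" "\<And>x. 0 \<le> f x" "0 < t" "measure_pmf.expectation P f \<le> e"
  shows "measure_pmf.prob P {x. \<not> f x \<le> t} \<le> e / t"
proof -
  have int: "integrable P f" using assms by (intro integrable_measure_pmf_finite)
  have "measure_pmf.prob P {x. \<not> f x \<le> t} \<le> measure_pmf.prob P {x\<in>space P. f x \<ge> t}"
    by (intro measure_pmf.finite_measure_mono) auto
  also have "\<dots> \<le> measure_pmf.expectation P f / t"
    by (rule integral_Markov_inequality_measure[OF int, where A="{}"]) (use assms in auto)
  also have "\<dots> \<le> e / t" using assms by (intro divide_right_mono) auto
  finally show ?thesis .
qed

text \<open>Chebyshev's inequality for the second moment with all coefficients equal to 1.\<close>

lemma prob_card_deviation:
  assumes p: "0 < p" "p \<le> 1" and n: "0 < n" and \<eta>: "0 < \<eta>"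
  shows "measure_pmf.prob (random_subset_pmf n p) {S. \<not> \<bar>real (card S) / p - real n\<bar> \<le> \<eta> * real n}
    \<le> (1 / p - 1) / (real n * \<eta>\<^sup>2)"
proof -
  let ?f = "\<lambda>S :: nat set. (real (card S) / p - real n)\<^sup>2"
  have E: "measure_pmf.expectation (random_subset_pmf n p) ?f \<le> (1 / p - 1) * real n"
    using second_moment_random_subset_le[OF p, of n "\<lambda>_. 1" 1] by simp
  have eq: "\<bar>y\<bar> \<le> \<eta> * real n \<longleftrightarrow> y\<^sup>2 \<le> (\<eta> * real n)\<^sup>2" for y
    using \<eta> by (simp add: abs_le_square_iff[symmetric])
  have "measure_pmf.prob (random_subset_pmf n p) {S. \<not> ?f S \<le> (\<eta> * real n)\<^sup>2}
      \<le> (1 / p - 1) * real n / (\<eta> * real n)\<^sup>2"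
    using n \<eta> E by (intro pmf_markov finite_random_subset_pmf) auto
  then show ?thesis unfolding eq using n by (simp add: power2_eq_square mult_ac)
qed

text \<open>Markov's inequality for the squared Frobenius error \<open>F\<close> of the Gram matrix.
  Each of its m^2 entries has second moment at most (1/p - 1) n L^4, and the threshold
  \<open>D\<^sup>2\<close> is \<eta>^2 L^4 n^2 m^2.\<close>

lemma prob_sigma1_row_deviation:
  assumes A: "A \<in> carrier_mat n m" and L: "0 < L" and AL: "\<And>i j. i < n \<Longrightarrow> j < m \<Longrightarrow> \<bar>A $$ (i, j)\<bar> \<le> L"
    and p: "0 < p" "p \<le> 1" and n: "0 < n" and \<eta>: "0 < \<eta>"
  shows "measure_pmf.prob (random_subset_pmf n p)
      {S. \<not> \<bar>(sigma1 (submatrix A S UNIV))\<^sup>2 / p - (sigma1 A)\<^sup>2\<bar> \<le> \<eta> * L\<^sup>2 * real n * real m}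
    \<le> (1 / p - 1) / (real n * \<eta>\<^sup>2)"
proof -
  let ?P = "random_subset_pmf n p"
  define F where "F = (\<lambda>S. \<Sum>j<m. \<Sum>l<m. ((\<Sum>i\<in>S. A $$ (i, j) * A $$ (i, l)) / p
              - (\<Sum>i<n. A $$ (i, j) * A $$ (i, l)))\<^sup>2)"
  define D where "D = \<eta> * L\<^sup>2 * real n * real m"
  have D: "0 \<le> D" unfolding D_def using \<eta> by simp
  have int: "integrable ?P f" for f :: "nat set \<Rightarrow> real"
    by (intro integrable_measure_pmf_finite finite_random_subset_pmf)
  have "measure_pmf.prob ?P {S. \<not> \<bar>(sigma1 (submatrix A S UNIV))\<^sup>2 / p - (sigma1 A)\<^sup>2\<bar> \<le> D}
      \<le> measure_pmf.prob ?P {S. \<not> F S \<le> D\<^sup>2}"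
    \<comment> \<open>The perturbation bound requires \<open>S \<subseteq> {..<n}\<close>, so the
      events are compared only on the support.\<close>
    by (intro measure_pmf.finite_measure_mono_AE AE_pmfI)
      (use sigma1_row_perturbation[OF A random_subset_pmf_subset p(1) D] in \<open>auto simp: F_def\<close>)
  also have "\<dots> \<le> (1 / p - 1) / (real n * \<eta>\<^sup>2)"
  \<comment> \<open>For \<open>m = 0\<close> the threshold is zero and Markov's inequality does not
    apply, but then \<open>F\<close> vanishes.\<close>
  proof (cases "m = 0")
    case True
    then show ?thesis unfolding F_def using p by simp
  next
    case False
    have "measure_pmf.expectation ?P F \<le> (\<Sum>j<m. \<Sum>l<m. (1 / p - 1) * (real n * (L * L)\<^sup>2))"
      unfolding F_def
      by (simp add: Bochner_Integration.integral_sum int del: sum_constant)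
        (intro sum_mono second_moment_random_subset_le p, use AL L in \<open>auto simp: abs_mult intro!: mult_mono\<close>)
    then have E: "measure_pmf.expectation ?P F \<le> real m * (real m * ((1 / p - 1) * (real n * (L * L)\<^sup>2)))"
      by simp
    have "measure_pmf.prob ?P {S. \<not> F S \<le> D\<^sup>2}
        \<le> real m * (real m * ((1 / p - 1) * (real n * (L * L)\<^sup>2))) / D\<^sup>2"
      using E False n L \<eta>
      by (intro pmf_markov finite_random_subset_pmf) (auto simp: F_def D_def intro!: sum_nonneg)
    also have "\<dots> = (1 / p - 1) / (real n * \<eta>\<^sup>2)"
      using False n L \<eta> p unfolding D_def by (simp add: field_simps power2_eq_square)
    finally show ?thesis .
  qed
  finally show ?thesis unfolding D_def .
qed

text \<open>Integrates the conditional bound over the first component. It is needed because the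
  matrix whose columns are sampled depends on the rows already chosen.\<close>

lemma prob_pair_pmf_le:
  assumes "\<And>x. x \<in> set_pmf P \<Longrightarrow> measure_pmf.prob Q {y. R x y} \<le> d" "0 \<le> d"
  shows "measure_pmf.prob (pair_pmf P Q) {(x, y). R x y} \<le> d"
proof -
  have "emeasure (pair_pmf P Q) {(x, y). R x y} = (\<integral>\<^sup>+z. indicator {(x, y). R x y} z \<partial>pair_pmf P Q)"
    by simp
  also have "\<dots> = (\<integral>\<^sup>+x. \<integral>\<^sup>+y. indicator {y. R x y} y \<partial>Q \<partial>P)"
    unfolding nn_integral_pair_pmf' by (simp add: indicator_def)
  also have "\<dots> = (\<integral>\<^sup>+x. emeasure Q {y. R x y} \<partial>P)" by simp
  also have "\<dots> \<le> (\<integral>\<^sup>+x. ennreal d \<partial>P)"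
    using assms
    by (intro nn_integral_mono_AE AE_pmfI) (simp add: measure_pmf.emeasure_eq_measure ennreal_leI)
  also have "\<dots> = ennreal d" by simp
  finally show ?thesis using assms(2) by (simp add: measure_pmf.emeasure_eq_measure)
qed

section \<open>From the deviation bounds to the sampling guarantee\<close>

text \<open>Here \<open>a\<close> and \<open>b\<close> are the sizes of the samples, and
  \<open>s0\<close>, \<open>s1\<close>, \<open>s2\<close> the squared \<open>sigma1\<close> of the
  matrix, of its sampled rows and of the final submatrix. With X = L^2 n m, the 6 is 3 + 2 + 1:
  replacing actual by expected sizes costs 3 \<eta> X, column sampling 2 \<eta> X and row sampling
  \<eta> X.\<close>

lemma rescaled_square_deviation:
  fixes a b n m p q L \<eta> s0 s1 s2 :: real
  assumes pos: "0 < a" "0 < b" "0 < n" "0 < m" "0 < p" "0 < q"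
    and \<eta>: "0 < \<eta>" "\<eta> \<le> 1"
    and a: "\<bar>a / p - n\<bar> \<le> \<eta> * n" and b: "\<bar>b / q - m\<bar> \<le> \<eta> * m"
    and s1: "\<bar>s1 / p - s0\<bar> \<le> \<eta> * L\<^sup>2 * n * m" and s2: "\<bar>s2 / q - s1\<bar> \<le> \<eta> * L\<^sup>2 * m * a"
    and s2_le: "0 \<le> s2" "s2 \<le> a * b * L\<^sup>2"
  shows "\<bar>n * m / (a * b) * s2 - s0\<bar> \<le> 6 * \<eta> * (L\<^sup>2 * n * m)"
proof -
  define u v X where "u = a / p" and "v = b / q" and "X = L\<^sup>2 * n * m"
  have X: "X \<ge> 0" unfolding X_def using pos by simp
  have uv: "0 < u" "0 < v" "u \<le> 2 * n" "v \<le> 2 * m"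
  proof -
    have "\<eta> * n \<le> n" "\<eta> * m \<le> m" using \<eta> pos by auto
    then show "u \<le> 2 * n" "v \<le> 2 * m" using a b unfolding u_def v_def by linarith+
  qed (use pos in \<open>auto simp: u_def v_def\<close>)
  have "\<bar>s2 / (p * q) - s1 / p\<bar> = \<bar>s2 / q - s1\<bar> / p"
    using pos by (simp add: field_simps abs_divide[symmetric] flip: abs_mult)
  also have "\<dots> \<le> \<eta> * L\<^sup>2 * m * a / p" using s2 pos by (intro divide_right_mono) auto
  also have "\<dots> = \<eta> * L\<^sup>2 * m * u" unfolding u_def by simp
  also have "\<dots> \<le> \<eta> * L\<^sup>2 * m * (2 * n)" using uv \<eta> pos by (intro mult_left_mono) auto
  finally have 1: "\<bar>s2 / (p * q) - s1 / p\<bar> \<le> 2 * (\<eta> * X)" unfolding X_def by (simp add: mult_ac)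
  have "\<bar>n * m - u * v\<bar> = \<bar>n * (m - v) + (n - u) * v\<bar>" by (simp add: algebra_simps)
  also have "\<dots> \<le> n * \<bar>m - v\<bar> + \<bar>n - u\<bar> * v"
    using pos uv by (intro order.trans[OF abs_triangle_ineq]) (simp add: abs_mult)
  also have "\<dots> \<le> n * (\<eta> * m) + (\<eta> * n) * (2 * m)"
    using a b uv pos \<eta> unfolding u_def[symmetric] v_def[symmetric]
    by (intro add_mono mult_mono) (auto simp: abs_minus_commute)
  finally have d: "\<bar>n * m - u * v\<bar> \<le> 3 * \<eta> * (n * m)" by (simp add: algebra_simps)
  \<comment> \<open>The factor \<open>s2 / (a * b)\<close> is at most \<open>L\<^sup>2\<close> by
    the bound on \<open>s2\<close>, so only the error of the sizes remains.\<close>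
  have "n * m / (a * b) * s2 - s2 / (p * q) = s2 / (a * b) * (n * m - u * v)"
    using pos unfolding u_def v_def by (simp add: field_simps)
  then have "\<bar>n * m / (a * b) * s2 - s2 / (p * q)\<bar> = s2 / (a * b) * \<bar>n * m - u * v\<bar>"
    using pos s2_le by (simp add: abs_mult)
  also have "\<dots> \<le> L\<^sup>2 * (3 * \<eta> * (n * m))"
    using d pos s2_le by (intro mult_mono) (auto simp: field_simps)
  finally have 2: "\<bar>n * m / (a * b) * s2 - s2 / (p * q)\<bar> \<le> 3 * (\<eta> * X)"
    unfolding X_def by (simp add: mult_ac)
  have 3: "\<bar>s1 / p - s0\<bar> \<le> \<eta> * X" using s1 unfolding X_def by (simp add: mult_ac)
  have "\<bar>w - s0\<bar> \<le> \<bar>w - y\<bar> + \<bar>y - z\<bar> + \<bar>z - s0\<bar>" for w y z by linarith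
  from order.trans[OF this add_mono[OF add_mono[OF 2 1] 3]]
  have "\<bar>n * m / (a * b) * s2 - s0\<bar> \<le> 6 * (\<eta> * X)" by (simp add: mult_ac)
  then show ?thesis unfolding X_def by (simp add: mult_ac)
qed

lemma abs_diff_le_of_squares:
  fixes x y d :: real
  assumes "0 \<le> x" "0 \<le> y" "0 \<le> d" "\<bar>x\<^sup>2 - y\<^sup>2\<bar> \<le> d\<^sup>2"
  shows "\<bar>x - y\<bar> \<le> d"
proof -
  have "\<bar>x - y\<bar>\<^sup>2 \<le> \<bar>x - y\<bar> * (x + y)"
    unfolding power2_eq_square using assms by (intro mult_left_mono) auto
  also have "\<dots> = \<bar>x\<^sup>2 - y\<^sup>2\<bar>"
    using assms by (simp add: power2_eq_square square_diff_square_factored abs_mult)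
  finally have "\<bar>x - y\<bar>\<^sup>2 \<le> d\<^sup>2" using assms by linarith
  then show ?thesis using assms(3) by (rule power2_le_imp_le)
qed

text \<open>The deterministic half of the argument: everything is derived from four deviation
  bounds, for the sizes of the two samples and for the two sampling steps.\<close>

lemma sampling_good_event:
  assumes A: "A \<in> carrier_mat n m" and L: "0 < L"
    and AL: "\<And>i j. i < n \<Longrightarrow> j < m \<Longrightarrow> \<bar>A $$ (i, j)\<bar> \<le> L"
    and nm: "0 < n" "0 < m" and pq: "0 < p" "0 < q" and pk: "p * real n \<le> k" "q * real m \<le> k"
    and \<epsilon>: "0 < \<epsilon>" "\<epsilon> \<le> 1" and S: "S \<subseteq> {..<n}" and T: "T \<subseteq> {..<m}"
    and cS: "\<bar>real (card S) / p - real n\<bar> \<le> \<epsilon>\<^sup>2 / 6 * real n"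
    and cT: "\<bar>real (card T) / q - real m\<bar> \<le> \<epsilon>\<^sup>2 / 6 * real m"
    and rS: "\<bar>(sigma1 (submatrix A S UNIV))\<^sup>2 / p - (sigma1 A)\<^sup>2\<bar> \<le> \<epsilon>\<^sup>2 / 6 * L\<^sup>2 * real n * real m"
    and rT: "\<bar>(sigma1 (submatrix (transpose_mat (submatrix A S UNIV)) T UNIV))\<^sup>2 / q
        - (sigma1 (transpose_mat (submatrix A S UNIV)))\<^sup>2\<bar> \<le> \<epsilon>\<^sup>2 / 6 * L\<^sup>2 * real m * real (card S)"
  shows "real (card S) \<le> 2 * k" "real (card T) \<le> 2 * k"
    "\<bar>sigma1 A - sqrt (real (n * m) / real (card S * card T)) * sigma1 (submatrix A S T)\<bar>
      \<le> \<epsilon> * L * sqrt (real (n * m))"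
proof -
  \<comment> \<open>Dividing by 6 offsets the constant in \<open>rescaled_square_deviation\<close>;
    squaring \<epsilon> pays for the passage from squared singular values to singular
    values.\<close>
  define \<eta> where "\<eta> = \<epsilon>\<^sup>2 / 6"
  have "\<epsilon>\<^sup>2 \<le> 1" using \<epsilon> by (simp add: power_le_one)
  then have \<eta>: "0 < \<eta>" "\<eta> \<le> 1 / 6" using \<epsilon> unfolding \<eta>_def by auto
  \<comment> \<open>A relative error of at most 1/6 makes both samples nonempty, so the rescaling
    factor is meaningful, and keeps them below the abort threshold.\<close>
  have card: "0 < real c" "real c \<le> 2 * k"
    if "0 < r" "0 < N" "r * real N \<le> k" "\<bar>real c / r - real N\<bar> \<le> \<epsilon>\<^sup>2 / 6 * real N" for r c N
  proof -
    have "\<eta> * real N \<le> 1 / 6 * real N" using \<eta> by (intro mult_right_mono) auto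
    with that(4) that(2) have c: "0 < real c / r" "real c / r \<le> 2 * real N"
      unfolding \<eta>_def[symmetric] by linarith+
    show "0 < real c" using c(1) that(1) by (simp add: zero_less_divide_iff)
    have "real c \<le> 2 * real N * r" using c(2) that(1) by (simp add: pos_divide_le_eq)
    then show "real c \<le> 2 * k" using that(3) by (simp add: mult_ac)
  qed
  have a: "0 < real (card S)" "real (card S) \<le> 2 * k"
    using card[OF pq(1) nm(1) pk(1) cS] by auto
  have b: "0 < real (card T)" "real (card T) \<le> 2 * k"
    using card[OF pq(2) nm(2) pk(2) cT] by auto
  show "real (card S) \<le> 2 * k" "real (card T) \<le> 2 * k" by (fact a(2) b(2))+
  define B where "B = submatrix A S UNIV"
  have B: "transpose_mat B \<in> carrier_mat m (card S)"
    using row_submatrix(1)[OF A S] unfolding B_def by simp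
  define Z where "Z = submatrix (transpose_mat B) T UNIV"
  have ST: "sigma1 (submatrix A S T) = sigma1 Z"
    unfolding Z_def B_def submatrix_rows_columns[OF A S T] sigma1_transpose ..
  have Z: "Z \<in> carrier_mat (card T) (card S)" unfolding Z_def by (rule row_submatrix[OF B T])
  have "(sigma1 Z)\<^sup>2 \<le> (\<Sum>j<card T. \<Sum>i<card S. (Z $$ (j, i))\<^sup>2)"
    by (rule sigma1_square_le_frobenius[OF Z])
  also have "\<dots> \<le> (\<Sum>j<card T. \<Sum>i<card S. L\<^sup>2)"
  proof (intro sum_mono)
    fix i j assume "j \<in> {..<card T}" "i \<in> {..<card S}"
    then have ij: "j < card T" "i < card S" by auto
    then have pk: "pick T j < m" "pick S i < n" using pick_in_set_le S T by blast+
    have "Z $$ (j, i) = A $$ (pick S i, pick T j)"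
      unfolding Z_def row_submatrix(2)[OF B T ij] using B pk ij row_submatrix[OF A S]
      by (simp add: B_def)
    then have "\<bar>Z $$ (j, i)\<bar> \<le> L" using AL[OF pk(2,1)] by simp
    then show "(Z $$ (j, i))\<^sup>2 \<le> L\<^sup>2" using L by (simp add: abs_le_square_iff[symmetric])
  qed
  finally have frob: "(sigma1 Z)\<^sup>2 \<le> real (card S) * real (card T) * L\<^sup>2" by (simp add: mult_ac)
  have "\<bar>real n * real m / (real (card S) * real (card T)) * (sigma1 Z)\<^sup>2 - (sigma1 A)\<^sup>2\<bar>
      \<le> 6 * \<eta> * (L\<^sup>2 * real n * real m)"
    using rS rT cS cT a b nm pq \<eta> frob
    by (intro rescaled_square_deviation[where p=p and q=q and ?s1.0="(sigma1 B)\<^sup>2"])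
      (auto simp: \<eta>_def B_def Z_def sigma1_transpose)
  also have "\<dots> = (\<epsilon> * L * sqrt (real (n * m)))\<^sup>2"
    unfolding \<eta>_def by (simp add: power_mult_distrib)
  finally have sq: "\<bar>(sigma1 A)\<^sup>2 - (sqrt (real (n * m) / real (card S * card T)) * sigma1 Z)\<^sup>2\<bar>
      \<le> (\<epsilon> * L * sqrt (real (n * m)))\<^sup>2"
    by (simp add: power_mult_distrib abs_minus_commute)
  show "\<bar>sigma1 A - sqrt (real (n * m) / real (card S * card T)) * sigma1 (submatrix A S T)\<bar>
      \<le> \<epsilon> * L * sqrt (real (n * m))"
    unfolding ST
  proof (rule abs_diff_le_of_squares[OF sigma1_nonneg _ _ sq])
    show "0 \<le> sqrt (real (n * m) / real (card S * card T)) * sigma1 Z"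
      by (intro mult_nonneg_nonneg sigma1_nonneg real_sqrt_ge_zero divide_nonneg_nonneg of_nat_0_le_iff)
    show "0 \<le> \<epsilon> * L * sqrt (real (n * m))" using \<epsilon> L by simp
  qed
qed

text \<open>Four bad events of probability at most 1/12 each leave a success probability of at least
  2/3 by the union bound.\<close>

lemma sampling_procedure_success:
  assumes A: "A \<in> carrier_mat n m" and L: "0 < L"
    and AL: "\<And>i j. i < n \<Longrightarrow> j < m \<Longrightarrow> \<bar>A $$ (i, j)\<bar> \<le> L"
    and nm: "0 < n" "0 < m" and k: "0 < k" and \<epsilon>: "0 < \<epsilon>" "\<epsilon> \<le> 1"
  defines "p \<equiv> min 1 (k / real n)" and "q \<equiv> min 1 (k / real m)"
  assumes var: "(1 / p - 1) / real n \<le> (\<epsilon>\<^sup>2 / 6)\<^sup>2 / 12" "(1 / q - 1) / real m \<le> (\<epsilon>\<^sup>2 / 6)\<^sup>2 / 12"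
  shows "measure_pmf.prob (sampling_procedure A k)
    {Some z |z. \<bar>sigma1 A - z\<bar> \<le> \<epsilon> * L * sqrt (real (n * m))} \<ge> 2 / 3"
proof -
  define \<eta> where "\<eta> = \<epsilon>\<^sup>2 / 6"
  have \<eta>: "0 < \<eta>" using \<epsilon> unfolding \<eta>_def by simp
  define P Q where "P = random_subset_pmf n p" and "Q = random_subset_pmf m q"
  have p: "0 < p" "p \<le> 1" and q: "0 < q" "q \<le> 1" using k nm unfolding p_def q_def by auto
  have pk: "p * real n \<le> k" "q * real m \<le> k" using nm unfolding p_def q_def
    by (auto simp: min_def field_simps)
  have v: "(1 / p - 1) / (real n * \<eta>\<^sup>2) \<le> 1 / 12" "(1 / q - 1) / (real m * \<eta>\<^sup>2) \<le> 1 / 12"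
  proof -
    have "x / (N * \<eta>\<^sup>2) \<le> 1 / 12" if "x / N \<le> \<eta>\<^sup>2 / 12" for x N
      using divide_right_mono[OF that, of "\<eta>\<^sup>2"] \<eta> by simp
    then show "(1 / p - 1) / (real n * \<eta>\<^sup>2) \<le> 1 / 12" "(1 / q - 1) / (real m * \<eta>\<^sup>2) \<le> 1 / 12"
      using var unfolding \<eta>_def by blast+
  qed
  define R1 where "R1 = (\<lambda>S :: nat set. \<bar>real (card S) / p - real n\<bar> \<le> \<eta> * real n)"
  define R2 where "R2 = (\<lambda>S. \<bar>(sigma1 (submatrix A S UNIV))\<^sup>2 / p - (sigma1 A)\<^sup>2\<bar> \<le> \<eta> * L\<^sup>2 * real n * real m)"
  define R3 where "R3 = (\<lambda>T :: nat set. \<bar>real (card T) / q - real m\<bar> \<le> \<eta> * real m)"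
  define R4 where "R4 = (\<lambda>S T. \<bar>(sigma1 (submatrix (transpose_mat (submatrix A S UNIV)) T UNIV))\<^sup>2 / q
        - (sigma1 (transpose_mat (submatrix A S UNIV)))\<^sup>2\<bar> \<le> \<eta> * L\<^sup>2 * real m * real (card S))"
  have 1: "measure_pmf.prob P {S. \<not> R1 S} \<le> 1 / 12"
    unfolding P_def R1_def using prob_card_deviation[OF p nm(1) \<eta>] v(1) by (rule order.trans)
  have 2: "measure_pmf.prob P {S. \<not> R2 S} \<le> 1 / 12"
    unfolding P_def R2_def using prob_sigma1_row_deviation[OF A L AL p nm(1) \<eta>] v(1) by (rule order.trans)
  have 3: "measure_pmf.prob Q {T. \<not> R3 T} \<le> 1 / 12"
    unfolding Q_def R3_def using prob_card_deviation[OF q nm(2) \<eta>] v(2) by (rule order.trans)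
  \<comment> \<open>For fixed \<open>S\<close>, column sampling is row sampling of the transposed
    row submatrix, whose entries are still bounded by \<open>L\<close>.\<close>
  have 4: "measure_pmf.prob Q {T. \<not> R4 S T} \<le> 1 / 12" if "S \<in> set_pmf P" for S
  proof -
    have S: "S \<subseteq> {..<n}" using that unfolding P_def by (rule random_subset_pmf_subset)
    have B: "transpose_mat (submatrix A S UNIV) \<in> carrier_mat m (card S)"
      using row_submatrix(1)[OF A S] by simp
    have "\<bar>transpose_mat (submatrix A S UNIV) $$ (j, i)\<bar> \<le> L" if "j < m" "i < card S" for j i
    proof -
      have "pick S i < n" using pick_in_set_le that S by blast
      then show ?thesis using that AL row_submatrix[OF A S] by simp
    qed
    from prob_sigma1_row_deviation[OF B L this q nm(2) \<eta>] v(2) show ?thesis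
      unfolding Q_def R4_def by (rule order.trans)
  qed
  let ?PQ = "pair_pmf P Q"
  have fst: "measure_pmf.prob ?PQ {(S, T). \<not> R S} = measure_pmf.prob P {S. \<not> R S}" for R
  proof -
    have "{(S, T). \<not> R S} = fst -` {S. \<not> R S}" by auto
    then show ?thesis by (metis measure_map_pmf map_fst_pair_pmf)
  qed
  define bad where "bad = ({(S, T). \<not> R1 S} \<union> {(S, T). \<not> R2 S}) \<union> ({(S, T). \<not> R3 T} \<union> {(S, T). \<not> R4 S T})"
  have "measure_pmf.prob ?PQ bad \<le>
      (measure_pmf.prob ?PQ {(S, T). \<not> R1 S} + measure_pmf.prob ?PQ {(S, T). \<not> R2 S})
      + (measure_pmf.prob ?PQ {(S, T). \<not> R3 T} + measure_pmf.prob ?PQ {(S, T). \<not> R4 S T})"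
    unfolding bad_def by (intro order.trans[OF measure_Un_le] add_mono measure_Un_le) auto
  also have "\<dots> \<le> (1 / 12 + 1 / 12) + (1 / 12 + 1 / 12)"
    unfolding fst using 1 2 3 4 by (intro add_mono prob_pair_pmf_le) auto
  finally have "2 / 3 \<le> measure_pmf.prob ?PQ (- bad)"
    using measure_pmf.prob_compl[of bad ?PQ] by (simp add: Compl_eq_Diff_UNIV)
  also have "\<dots> \<le> measure_pmf.prob (sampling_procedure A k)
      {Some z |z. \<bar>sigma1 A - z\<bar> \<le> \<epsilon> * L * sqrt (real (n * m))}"
  proof -
    have dims: "dim_row A = n" "dim_col A = m" using A by auto
    show ?thesis
      unfolding sampling_procedure_def dims Let_def measure_map_pmf
        p_def[symmetric] q_def[symmetric] P_def[symmetric] Q_def[symmetric]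
    proof (intro measure_pmf.finite_measure_mono_AE AE_pmfI impI)
      fix x assume x: "x \<in> set_pmf ?PQ" "x \<in> - bad"
      obtain S T where ST: "x = (S, T)" by (cases x)
      have "S \<subseteq> {..<n}" "T \<subseteq> {..<m}"
        using x(1) random_subset_pmf_subset unfolding ST P_def Q_def by auto
      moreover have "R1 S" "R2 S" "R3 T" "R4 S T" using x(2) unfolding ST bad_def by auto
      ultimately have "real (card S) \<le> 2 * k" "real (card T) \<le> 2 * k"
        "\<bar>sigma1 A - sqrt (real (n * m) / real (card S * card T)) * sigma1 (submatrix A S T)\<bar>
          \<le> \<epsilon> * L * sqrt (real (n * m))"
        using sampling_good_event[OF A L AL nm p(1) q(1) pk \<epsilon>, of S T]
        unfolding R1_def R2_def R3_def R4_def \<eta>_def by blast+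
      then show "x \<in> (\<lambda>(S\<^sub>R, S\<^sub>C).
           if real (card S\<^sub>R) > 2 * k \<or> real (card S\<^sub>C) > 2 * k then None
           else Some (sqrt (real (n * m) / real (card S\<^sub>R * card S\<^sub>C))
                        * sigma1 (submatrix A S\<^sub>R S\<^sub>C))) -`
          {Some z |z. \<bar>sigma1 A - z\<bar> \<le> \<epsilon> * L * sqrt (real (n * m))}"
        unfolding ST by auto
    qed simp
  qed
  finally show ?thesis .
qed

section \<open>The prescribed sample size\<close>

text \<open>The constant is 432 = 12 * 6^2, from the required variance bound
  \<open>(\<epsilon>\<^sup>2 / 6)\<^sup>2 / 12\<close>. For small \<epsilon> the power term of the
  sample size is large enough; otherwise the logarithmic term is, as some dimension is at least
  2.\<close>

lemma sample_size_ge: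
  assumes \<epsilon>: "0 < \<epsilon>" "\<epsilon> \<le> 1" and nm: "0 < n" "0 < m" "\<not> (n = 1 \<and> m = 1)"
  shows "432 / \<epsilon> ^ 4 \<le> sample_size 7000 n m \<epsilon>"
proof (cases "\<epsilon> \<le> 1 / 2")
  case True
  have \<epsilon>2: "\<epsilon>\<^sup>2 \<le> 1" using \<epsilon> by (simp add: power_le_one)
  have inv: "2 \<le> 1 / \<epsilon>" using True \<epsilon> by (simp add: field_simps)
  \<comment> \<open>Nine of the thirteen factors 1/\<epsilon> absorb 432, the other four give
    \<epsilon>^-4; the exponent \<open>7000 / \<epsilon>\<^sup>2\<close> is well above 13.\<close>
  have "432 \<le> (2::real) ^ 9" by simp
  also have "\<dots> \<le> (1 / \<epsilon>) ^ 9" using inv by (intro power_mono) auto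
  finally have "432 * (1 / \<epsilon>) ^ 4 \<le> (1 / \<epsilon>) ^ 9 * (1 / \<epsilon>) ^ 4"
    using \<epsilon> by (intro mult_right_mono) auto
  then have "432 / \<epsilon> ^ 4 \<le> (1 / \<epsilon>) ^ 13" by (simp add: power_divide flip: power_add)
  also have "\<dots> = (1 / \<epsilon>) powr 13" using \<epsilon> powr_realpow[of "1 / \<epsilon>" 13] by simp
  also have "\<dots> \<le> (1 / \<epsilon>) powr (7000 / \<epsilon>\<^sup>2)"
    using inv \<epsilon> \<epsilon>2 by (intro powr_mono) (auto simp: field_simps)
  also have "\<dots> \<le> sample_size 7000 n m \<epsilon>" unfolding sample_size_def by (rule max.cobounded2)
  finally show ?thesis .
next
  case False
  have ln: "1 / 4 \<le> (ln (real N))\<^sup>2" if "2 \<le> N" for N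
  proof -
    have "1 / 2 \<le> ln (2::real)" using ln2_ge_two_thirds by simp
    also have "\<dots> \<le> ln (real N)" using that by simp
    finally have "(1 / 2)\<^sup>2 \<le> (ln (real N))\<^sup>2" by (intro power_mono) auto
    then show ?thesis by (simp add: power2_eq_square)
  qed
  have "2 \<le> n \<or> 2 \<le> m" using nm by linarith
  then have *: "1 / 4 \<le> max ((ln (real n))\<^sup>2) ((ln (real m))\<^sup>2)"
    using ln[of n] ln[of m] by (auto simp: le_max_iff_disj)
  have "(1 / 2)\<^sup>2 \<le> \<epsilon>\<^sup>2" using False by (intro power_mono) auto
  \<comment> \<open>This fixes the order of magnitude of 7000: one factor 1/4 comes from the squared
    logarithm and one from \<epsilon>^2, and 7000/16 = 437.5 still exceeds 432.\<close>
  then have "432 \<le> 1750 * \<epsilon>\<^sup>2" by (simp add: power2_eq_square)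
  then have "432 / \<epsilon> ^ 4 \<le> 1750 * \<epsilon>\<^sup>2 / \<epsilon> ^ 4" by (intro divide_right_mono) auto
  also have "\<dots> = 1750 / \<epsilon>\<^sup>2" using \<epsilon> by (simp add: field_simps flip: power_add)
  also have "\<dots> \<le> 7000 * max ((ln (real n))\<^sup>2) ((ln (real m))\<^sup>2) / \<epsilon>\<^sup>2"
    using * by (intro divide_right_mono) auto
  also have "\<dots> \<le> sample_size 7000 n m \<epsilon>" unfolding sample_size_def by (rule max.cobounded1)
  finally show ?thesis .
qed

text \<open>The power term has base at least 1 and a nonnegative exponent. This covers
  \<open>n = m = 1\<close>, where the logarithms vanish but a sample size of 1 already keeps the
  whole matrix.\<close>

lemma sample_size_ge_1: "0 < \<epsilon> \<Longrightarrow> \<epsilon> \<le> 1 \<Longrightarrow> 1 \<le> sample_size 7000 n m \<epsilon>"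
  unfolding sample_size_def by (intro max.coboundedI2 ge_one_powr_ge_zero) auto

theorem theorem5p3:
  shows "\<exists>C>0. \<forall>(n::nat) (m::nat) (L::real) (A::real mat) (\<epsilon>::real).
    n > 0 \<longrightarrow> m > 0 \<longrightarrow> L > 0 \<longrightarrow> A \<in> carrier_mat n m \<longrightarrow>
    (\<forall>i<n. \<forall>j<m. A $$ (i, j) \<in> {-L..L}) \<longrightarrow>
    0 < \<epsilon> \<longrightarrow> \<epsilon> \<le> 1 \<longrightarrow>
    measure_pmf.prob (sampling_procedure A (sample_size C n m \<epsilon>))
      {Some z |z. \<bar>sigma1 A - z\<bar> \<le> \<epsilon> * L * sqrt (real (n * m))} \<ge> 2 / 3"
proof (intro exI[of _ 7000] conjI allI impI)
  fix n m :: nat and L :: real and A :: "real mat" and \<epsilon> :: real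
  assume nm: "n > 0" "m > 0" and L: "L > 0" and A: "A \<in> carrier_mat n m"
    and AL: "\<forall>i<n. \<forall>j<m. A $$ (i, j) \<in> {-L..L}" and \<epsilon>: "0 < \<epsilon>" "\<epsilon> \<le> 1"
  have AL': "\<bar>A $$ (i, j)\<bar> \<le> L" if "i < n" "j < m" for i j
    using AL that by (force simp: abs_le_iff)
  define k where "k = sample_size 7000 n m \<epsilon>"
  have k1: "1 \<le> k" unfolding k_def by (rule sample_size_ge_1[OF \<epsilon>])
  have var: "(1 / min 1 (k / real N) - 1) / real N \<le> (\<epsilon>\<^sup>2 / 6)\<^sup>2 / 12" if N: "N = n \<or> N = m" for N
  \<comment> \<open>If \<open>N \<le> k\<close>, the capped inclusion probability is 1 and there is
    no variance. Otherwise \<open>N > k \<ge> 1\<close> rules out the 1-by-1 matrix, and the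
    variance term is at most \<open>1 / k\<close>.\<close>
  proof (cases "real N \<le> k")
    case True
    then have "min 1 (k / real N) = 1" using N nm by (auto simp: min_def field_simps)
    then show ?thesis by simp
  next
    case False
    then have "\<not> (n = 1 \<and> m = 1)" using N k1 by auto
    then have k: "432 / \<epsilon> ^ 4 \<le> k" unfolding k_def by (rule sample_size_ge[OF \<epsilon> nm])
    have "min 1 (k / real N) = k / real N" using False k1 by (simp add: min_def field_simps)
    then have "(1 / min 1 (k / real N) - 1) / real N \<le> 1 / k"
      using k1 False by (simp add: field_simps)
    also have "\<dots> \<le> 1 / (432 / \<epsilon> ^ 4)" using k k1 \<epsilon> by (intro divide_left_mono) auto
    also have "\<dots> = (\<epsilon>\<^sup>2 / 6)\<^sup>2 / 12" by (simp add: power_divide)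
    finally show ?thesis .
  qed
  show "measure_pmf.prob (sampling_procedure A (sample_size 7000 n m \<epsilon>))
      {Some z |z. \<bar>sigma1 A - z\<bar> \<le> \<epsilon> * L * sqrt (real (n * m))} \<ge> 2 / 3"
    unfolding k_def[symmetric] using AL' k1 var
    by (intro sampling_procedure_success[OF A L _ nm _ \<epsilon>]) auto
qed simp

end
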